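(* Let $r$ be a nonnegative integer. Let $f_1,\ldots,f_k$ be $\mathcal D^r$ functions on $F^n$ such that $S=\{x\in F^n\;|\;f_i(x)\ge 0\ (i=1,\ldots,k)\}$ is nonempty, and let $g$ be a $\mathcal D^r$ function on $F^n$. (i) If $g\ge 0$ on $S$, there exist $\mathcal D^r$ functions $p,v_0,\ldots,v_k$ on $F^n$ such that $p^{-1}(0)\subseteq g^{-1}(0)$ and $p^2g=v_0^2+\sum_{i=1}^k v_i^2f_i$. (ii) If $g>0$ on $S$, there exist $\mathcal D^r$ functions $v_0,\ldots,v_k$ on $F^n$ such that $g=v_0^2+\sum_{i=1}^k v_i^2f_i$.
   Context: Throughout, $\mathcal F=(F,<,+,\cdot,0,1,\ldots)$ is a definably complete locally o-minimal expansion of an ordered field: locally o-minimal means that for every definable $X\subseteq F$ and every $a\in F$ there is an open interval $I\ni a$ such that $X\cap I$ is a finite union of points and open intervals; definably complete means every definable subset of $F$ has a supremum and an infimum in $F\cup\{\pm\infty\}$. "Definable" means definable with parameters. $\mathcal D^r$ means definable and of class $\mathcal C^r$ ($r=0$: continuous). *)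

theory Defs
  imports Main
begin

text \<open>Points of F^n are lists of length n over the ordered field 'a.
 A (first-order) expansion of the ordered field F is represented, following van den Dries,
 by the family S n of its definable (with parameters) subsets of F^n.\<close>

definition Fn :: "nat \<Rightarrow> 'a list set" where
  "Fn n = {x. length x = n}"

definition dstructure :: "(nat \<Rightarrow> 'a::linordered_field list set set) \<Rightarrow> bool" where
  "dstructure S \<longleftrightarrow>
     (\<forall>n. \<forall>A\<in>S n. A \<subseteq> Fn n) \<and>
     (\<forall>n. {} \<in> S n) \<and>
     (\<forall>n. \<forall>A\<in>S n. \<forall>B\<in>S n. A \<union> B \<in> S n) \<and>
     (\<forall>n. \<forall>A\<in>S n. Fn n - A \<in> S n) \<and>
     (\<forall>n. \<forall>A\<in>S n. {x @ [y] | x y. x \<in> A} \<in> S (Suc n) \<and> {y # x | x y. x \<in> A} \<in> S (Suc n)) \<and>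
     (\<forall>n i j. i < n \<and> j < n \<longrightarrow> {x \<in> Fn n. x ! i = x ! j} \<in> S n) \<and>
     (\<forall>n. \<forall>A\<in>S (Suc n). butlast ` A \<in> S n) \<and>
     (\<forall>a. {[a]} \<in> S 1) \<and>
     {[x, y] | x y. x < y} \<in> S 2 \<and>
     {[x, y, x + y] | x y. True} \<in> S 3 \<and>
     {[x, y, x * y] | x y. True} \<in> S 3"

definition pts :: "'a list set \<Rightarrow> 'a set" where
  "pts X = {x. [x] \<in> X}"

definition def_complete :: "(nat \<Rightarrow> 'a::linordered_field list set set) \<Rightarrow> bool" where
  "def_complete S \<longleftrightarrow>
     (\<forall>X\<in>S 1. pts X \<noteq> {} \<and> (\<exists>b. \<forall>x\<in>pts X. x \<le> b) \<longrightarrow>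
        (\<exists>s. (\<forall>x\<in>pts X. x \<le> s) \<and> (\<forall>b. (\<forall>x\<in>pts X. x \<le> b) \<longrightarrow> s \<le> b))) \<and>
     (\<forall>X\<in>S 1. pts X \<noteq> {} \<and> (\<exists>b. \<forall>x\<in>pts X. b \<le> x) \<longrightarrow>
        (\<exists>s. (\<forall>x\<in>pts X. s \<le> x) \<and> (\<forall>b. (\<forall>x\<in>pts X. b \<le> x) \<longrightarrow> b \<le> s)))"

definition loc_omin :: "(nat \<Rightarrow> 'a::linordered_field list set set) \<Rightarrow> bool" where
  "loc_omin S \<longleftrightarrow>
     (\<forall>X\<in>S 1. \<forall>a. \<exists>c d. c < a \<and> a < d \<and>
        (\<exists>P. finite P \<and>
             (\<forall>J\<in>P. (\<exists>p. J = {p}) \<or> (\<exists>u v. u < v \<and> J = {u<..<v})) \<and>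
             pts X \<inter> {c<..<d} = \<Union>P))"

definition definable_fun :: "(nat \<Rightarrow> 'a list set set) \<Rightarrow> nat \<Rightarrow> ('a list \<Rightarrow> 'a) \<Rightarrow> bool" where
  "definable_fun S n f \<longleftrightarrow> {x @ [f x] | x. x \<in> Fn n} \<in> S (Suc n)"

definition cont_Fn :: "nat \<Rightarrow> ('a::linordered_field list \<Rightarrow> 'a) \<Rightarrow> bool" where
  "cont_Fn n f \<longleftrightarrow> (\<forall>x\<in>Fn n. \<forall>e>0. \<exists>d>0. \<forall>y\<in>Fn n.
      (\<forall>i<n. \<bar>y ! i - x ! i\<bar> < d) \<longrightarrow> \<bar>f y - f x\<bar> < e)"

definition has_pderiv :: "nat \<Rightarrow> ('a::linordered_field list \<Rightarrow> 'a) \<Rightarrow> 'a list \<Rightarrow> 'a \<Rightarrow> bool" where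
  "has_pderiv i f x L \<longleftrightarrow> (\<forall>e>0. \<exists>d>0. \<forall>t. t \<noteq> 0 \<and> \<bar>t\<bar> < d \<longrightarrow>
      \<bar>(f (x[i := x ! i + t]) - f x) / t - L\<bar> < e)"

fun Cr :: "nat \<Rightarrow> nat \<Rightarrow> ('a::linordered_field list \<Rightarrow> 'a) \<Rightarrow> bool" where
  "Cr 0 n f = cont_Fn n f"
| "Cr (Suc r) n f = (cont_Fn n f \<and>
      (\<forall>i<n. \<exists>D. (\<forall>x\<in>Fn n. has_pderiv i f x (D x)) \<and> Cr r n D))"

definition Dr :: "(nat \<Rightarrow> 'a::linordered_field list set set) \<Rightarrow> nat \<Rightarrow> nat \<Rightarrow> ('a list \<Rightarrow> 'a) \<Rightarrow> bool" where
  "Dr S r n f \<longleftrightarrow> definable_fun S n f \<and> Cr r n f"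

end

theory Submission
  imports Defs
begin

text \<open>Let sqrt denote the square root of the positive part, which exists by definable completeness.
  Its powers of exponent at least 2r+1 are of class C^r, so w_i = sqrt(-f_i)^(2r+1) is a D^r function
  that vanishes where f_i is nonnegative (neg_wt below). Hence N = - (sum of w_i^2 f_i) (defect below) is nonnegative, and
  positive exactly off the set S. Taking v_i = b w_i turns the required identities into
  p^2 g + b^2 N = v_0^2. Put D = N + sqrt(g)^(2r+1). In (i), take p = g^r D^(r+1),
  b = sqrt(-g)^(2r+1) sqrt(N)^(2r+1) and v_0 = sqrt(g)^(2r+1) D^(r+1). In (ii), D is positive
  everywhere and b = (1 + g^2 + N^2) / D makes g + b^2 N positive, so that it is the square
  of a D^r function.\<close>

section \<open>Definable sets and functions\<close>

locale definable_family =
  fixes S :: "nat \<Rightarrow> 'a::linordered_field list set set"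
  assumes dstructure: "dstructure S"
begin

text \<open>Definable sets are handled as formulas in the coordinates, so that the closure axioms of
  \<open>dstructure\<close> become rules for connectives, quantifiers and atomic relations.\<close>

definition dset :: "nat \<Rightarrow> ('a list \<Rightarrow> bool) \<Rightarrow> bool" where
  "dset n P \<longleftrightarrow> {x \<in> Fn n. P x} \<in> S n"

lemma
  shows S_subset [rule_format]: "\<forall>n. \<forall>A\<in>S n. A \<subseteq> Fn n"
    and S_empty: "\<forall>n. {} \<in> S n"
    and S_Un [rule_format]: "\<forall>n. \<forall>A\<in>S n. \<forall>B\<in>S n. A \<union> B \<in> S n"
    and S_Diff [rule_format]: "\<forall>n. \<forall>A\<in>S n. Fn n - A \<in> S n"
    and S_cylinder [rule_format]: "\<forall>n. \<forall>A\<in>S n. {x @ [y] | x y. x \<in> A} \<in> S (Suc n) \<and>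
      {y # x | x y. x \<in> A} \<in> S (Suc n)"
    and S_diagonal [rule_format]: "\<forall>n i j. i < n \<and> j < n \<longrightarrow> {x \<in> Fn n. x ! i = x ! j} \<in> S n"
    and S_projection [rule_format]: "\<forall>n. \<forall>A\<in>S (Suc n). butlast ` A \<in> S n"
    and S_singleton [rule_format]: "\<forall>a. {[a]} \<in> S 1"
    and S_less: "{[x, y] | x y. x < y} \<in> S 2"
    and S_add: "{[x, y, x + y] | x y. True} \<in> S 3"
    and S_mult: "{[x, y, x * y] | x y. True} \<in> S 3"
  using dstructure unfolding dstructure_def by - (elim conjE, assumption)+

lemma dset_not: "dset n P \<Longrightarrow> dset n (\<lambda>x. \<not> P x)"
proof -
  assume "dset n P"
  then have "Fn n - {x \<in> Fn n. P x} \<in> S n"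
    unfolding dset_def by (rule S_Diff)
  moreover have "Fn n - {x \<in> Fn n. P x} = {x \<in> Fn n. \<not> P x}" by blast
  ultimately show ?thesis by (simp add: dset_def)
qed

lemma dset_disj: "dset n P \<Longrightarrow> dset n Q \<Longrightarrow> dset n (\<lambda>x. P x \<or> Q x)"
proof -
  assume "dset n P" "dset n Q"
  then have "{x \<in> Fn n. P x} \<union> {x \<in> Fn n. Q x} \<in> S n"
    unfolding dset_def by (rule S_Un)
  moreover have "{x \<in> Fn n. P x} \<union> {x \<in> Fn n. Q x} = {x \<in> Fn n. P x \<or> Q x}" by blast
  ultimately show ?thesis by (simp add: dset_def)
qed

lemma dset_conj: "dset n P \<Longrightarrow> dset n Q \<Longrightarrow> dset n (\<lambda>x. P x \<and> Q x)"
  using dset_not[OF dset_disj[OF dset_not dset_not]] by simp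

lemma dset_cong:
  assumes "dset n P" "\<And>x. length x = n \<Longrightarrow> P x = Q x"
  shows "dset n Q"
proof -
  have "{x \<in> Fn n. P x} = {x \<in> Fn n. Q x}" using assms(2) by (auto simp: Fn_def)
  with assms(1) show ?thesis by (simp add: dset_def)
qed

lemma dset_mem: "A \<in> S n \<Longrightarrow> dset n (\<lambda>x. x \<in> A)"
proof -
  assume A: "A \<in> S n"
  then have "{x \<in> Fn n. x \<in> A} = A" using S_subset by blast
  with A show ?thesis by (simp add: dset_def)
qed

lemma dset_False: "dset n (\<lambda>_. False)"
  using S_empty by (simp add: dset_def)

lemma dset_eq: "i < n \<Longrightarrow> j < n \<Longrightarrow> dset n (\<lambda>x. x ! i = x ! j)"
  unfolding dset_def by (rule S_diagonal) simp

lemma dset_ball: "(\<And>j. j < m \<Longrightarrow> dset n (P j)) \<Longrightarrow> dset n (\<lambda>x. \<forall>j<m. P j x)"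
  for m :: nat
proof (induction m)
  case 0
  then show ?case using dset_not[OF dset_False] by simp
next
  case (Suc m)
  then have "dset n (\<lambda>x. (\<forall>j<m. P j x) \<and> P m x)" by (intro dset_conj) auto
  then show ?case by (rule dset_cong) (auto simp: less_Suc_eq)
qed

text \<open>Leading coordinates are added one at a time by the cylinder axiom that prepends a
  coordinate. This is what places a definable set on the last \<open>m\<close> of
  \<open>n + m\<close> coordinates in \<open>dset_subst\<close>.\<close>

lemma dset_drop: "A \<in> S m \<Longrightarrow> dset (n + m) (\<lambda>z. drop n z \<in> A)"
proof (induction n)
  case 0
  then show ?case by (simp add: dset_mem)
next
  case (Suc n)
  then have "{y # x |x y. x \<in> {z \<in> Fn (n + m). drop n z \<in> A}} \<in> S (Suc (n + m))"
    unfolding dset_def by (intro S_cylinder[THEN conjunct2]) simp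
  moreover have "{y # x |x y. x \<in> {z \<in> Fn (n + m). drop n z \<in> A}}
      = {z \<in> Fn (Suc n + m). drop (Suc n) z \<in> A}"
    by (auto simp: Fn_def length_Suc_conv)
  ultimately show ?case by (simp add: dset_def)
qed

lemma dset_Ex:
  assumes "dset (Suc n) P"
  shows "dset n (\<lambda>x. \<exists>y. P (x @ [y]))"
proof -
  have "butlast ` {x \<in> Fn (Suc n). P x} \<in> S n"
    using assms unfolding dset_def by (rule S_projection)
  moreover have "butlast ` {x \<in> Fn (Suc n). P x} = {x \<in> Fn n. \<exists>y. P (x @ [y])}"
  proof (intro subset_antisym subsetI)
    fix x assume "x \<in> butlast ` {x \<in> Fn (Suc n). P x}"
    then obtain z where "length z = Suc n" "P z" "x = butlast z" by (auto simp: Fn_def)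
    then show "x \<in> {x \<in> Fn n. \<exists>y. P (x @ [y])}"
      by (cases z rule: rev_cases) (auto simp: Fn_def)
  next
    fix x assume "x \<in> {x \<in> Fn n. \<exists>y. P (x @ [y])}"
    then obtain y where "length x = n" "P (x @ [y])" by (auto simp: Fn_def)
    then show "x \<in> butlast ` {x \<in> Fn (Suc n). P x}"
      by (auto simp: Fn_def intro!: image_eqI[of _ _ "x @ [y]"])
  qed
  ultimately show ?thesis by (simp add: dset_def)
qed

lemma dset_Ex_append:
  "dset (n + m) P \<Longrightarrow> dset n (\<lambda>x. \<exists>y. length y = m \<and> P (x @ y))"
proof (induction m arbitrary: P)
  case 0
  then show ?case by simp
next
  case (Suc m)
  have "dset n (\<lambda>x. \<exists>y. length y = m \<and> (\<exists>a. P ((x @ y) @ [a])))"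
    using Suc.IH[OF dset_Ex] Suc.prems by simp
  moreover have "(\<exists>y. length y = m \<and> (\<exists>a. P ((x @ y) @ [a])))
      = (\<exists>y. length y = Suc m \<and> P (x @ y))" for x
    by (metis append.assoc length_append_singleton length_Suc_conv_rev)
  ultimately show ?case by simp
qed

text \<open>Adjoin \<open>m\<close> new coordinates, require them to satisfy \<open>P\<close> and to
  agree with the chosen old coordinates through diagonals, and project them away. Since
  \<open>s\<close> is arbitrary, this covers permuting, repeating and omitting variables in a
  formula.\<close>

lemma dset_subst:
  assumes A: "dset m P" and s: "\<And>j. j < m \<Longrightarrow> s j < n"
  shows "dset n (\<lambda>x. P (map (\<lambda>j. x ! s j) [0..<m]))"
proof -
  have "dset (n + m) (\<lambda>z. drop n z \<in> {x \<in> Fn m. P x} \<and> (\<forall>j<m. z ! s j = z ! (n + j)))"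
  proof (intro dset_conj dset_ball dset_eq)
    show "dset (n + m) (\<lambda>z. drop n z \<in> {x \<in> Fn m. P x})"
      using A dset_drop unfolding dset_def by blast
  qed (use s in \<open>auto intro: trans_less_add1\<close>)
  from dset_Ex_append[OF this] show ?thesis
  proof (rule dset_cong)
    fix x :: "'a list" assume x: "length x = n"
    have nth: "(x @ y) ! s j = x ! s j" "(x @ y) ! (n + j) = y ! j" if "j < m" for y j
      using x s[OF that] by (simp_all add: nth_append)
    have *: "(y = map (\<lambda>j. x ! s j) [0..<m])
        = (length y = m \<and> (\<forall>j<m. (x @ y) ! s j = (x @ y) ! (n + j)))" for y
      unfolding list_eq_iff_nth_eq[of y] by (auto simp: nth)
    have "(\<exists>y. length y = m \<and> drop n (x @ y) \<in> {x \<in> Fn m. P x} \<and>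
            (\<forall>j<m. (x @ y) ! s j = (x @ y) ! (n + j)))
        = (\<exists>y. y = map (\<lambda>j. x ! s j) [0..<m] \<and> P y)"
      unfolding * using x by (auto simp: Fn_def)
    then show "(\<exists>y. length y = m \<and> drop n (x @ y) \<in> {x \<in> Fn m. P x} \<and>
            (\<forall>j<m. (x @ y) ! s j = (x @ y) ! (n + j)))
        = P (map (\<lambda>j. x ! s j) [0..<m])" by simp
  qed
qed

lemma dset_subst1:
  assumes "dset 1 P" "i < n"
  shows "dset n (\<lambda>x. P [x ! i])"
  using dset_subst[OF assms(1), of "\<lambda>_. i" n] assms(2) by simp

lemma dset_subst2:
  assumes "dset 2 P" "i < n" "j < n"
  shows "dset n (\<lambda>x. P [x ! i, x ! j])"
  using dset_subst[OF assms(1), of "(!) [i, j]" n] assms(2,3)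
  by (force simp: numeral_2_eq_2 less_Suc_eq)

lemma dset_subst3:
  assumes "dset 3 P" "i < n" "j < n" "k < n"
  shows "dset n (\<lambda>x. P [x ! i, x ! j, x ! k])"
  using dset_subst[OF assms(1), of "(!) [i, j, k]" n] assms(2-)
  by (force simp: numeral_3_eq_3 less_Suc_eq)

lemma dset_const: "i < n \<Longrightarrow> dset n (\<lambda>x. x ! i = c)"
  using dset_subst1[OF dset_mem[OF S_singleton], of i n c] by simp

lemma dset_less: "i < n \<Longrightarrow> j < n \<Longrightarrow> dset n (\<lambda>x. x ! i < x ! j)"
  using dset_subst2[OF dset_mem[OF S_less], of i n j] by auto

lemma dset_add: "i < n \<Longrightarrow> j < n \<Longrightarrow> k < n \<Longrightarrow> dset n (\<lambda>x. x ! k = x ! i + x ! j)"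
  using dset_subst3[OF dset_mem[OF S_add], of i n j k] by auto

lemma dset_mult: "i < n \<Longrightarrow> j < n \<Longrightarrow> k < n \<Longrightarrow> dset n (\<lambda>x. x ! k = x ! i * x ! j)"
  using dset_subst3[OF dset_mem[OF S_mult], of i n j k] by auto

section \<open>Definable functions through their graphs\<close>

lemma definable_fun_iff: "definable_fun S n f \<longleftrightarrow> dset (Suc n) (\<lambda>z. z ! n = f (take n z))"
proof -
  have "{x @ [f x] | x. x \<in> Fn n} = {z \<in> Fn (Suc n). z ! n = f (take n z)}"
  proof (intro subset_antisym subsetI)
    fix z assume "z \<in> {z \<in> Fn (Suc n). z ! n = f (take n z)}"
    then have "z = take n z @ [f (take n z)]" "take n z \<in> Fn n"
      by (auto simp: Fn_def) (metis lessI order_refl take_Suc_conv_app_nth take_all)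
    then show "z \<in> {x @ [f x] | x. x \<in> Fn n}" by blast
  qed (auto simp: Fn_def nth_append)
  then show ?thesis by (simp add: definable_fun_def dset_def)
qed

lemma dset_graph:
  assumes f: "definable_fun S n f" and "n \<le> N" "j < N"
  shows "dset N (\<lambda>x. x ! j = f (take n x))"
proof -
  \<comment> \<open>The substitution keeps the \<open>n\<close> arguments in place and sends the
    value coordinate of the graph to position \<open>j\<close>.\<close>
  have "dset N (\<lambda>x. map (\<lambda>i. x ! (if i < n then i else j)) [0..<Suc n] ! n
      = f (take n (map (\<lambda>i. x ! (if i < n then i else j)) [0..<Suc n])))"
    by (rule dset_subst[OF f[unfolded definable_fun_iff]]) (use assms in auto)
  then show ?thesis
  proof (rule dset_cong)
    fix x :: "'a list" assume "length x = N"
    then have "take n (map (\<lambda>i. x ! (if i < n then i else j)) [0..<Suc n]) = take n x"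
      using assms by (intro nth_equalityI) (auto simp del: upt_Suc)
    then show "(map (\<lambda>i. x ! (if i < n then i else j)) [0..<Suc n] ! n
      = f (take n (map (\<lambda>i. x ! (if i < n then i else j)) [0..<Suc n]))) = (x ! j = f (take n x))"
      by (simp del: upt_Suc)
  qed
qed

text \<open>The graph of \<open>h\<close> is described by "there are u, v with u = f x, v = g x and
  P u v z"; the witnesses u and v occupy the coordinates \<open>n + 1\<close> and
  \<open>n + 2\<close>, which are then projected away. A unary operation is covered by taking a
  constant for \<open>g\<close>, which also supplies that constant to the formula
  \<open>P\<close>.\<close>

lemma definable_funI:
  assumes f: "definable_fun S n f" and g: "definable_fun S n g" and P: "dset 3 P"
    and h: "\<And>x z. x \<in> Fn n \<Longrightarrow> P [f x, g x, z] \<longleftrightarrow> z = h x"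
  shows "definable_fun S n h"
proof -
  have "dset (Suc n + 2) (\<lambda>w. w ! (n + 1) = f (take n w) \<and> w ! (n + 2) = g (take n w)
      \<and> P [w ! (n + 1), w ! (n + 2), w ! n])"
    by (intro dset_conj dset_graph[OF f] dset_graph[OF g] dset_subst3[OF P]) auto
  from dset_Ex_append[OF this] show ?thesis
    unfolding definable_fun_iff
  proof (rule dset_cong)
    fix z :: "'a list" assume z: "length z = Suc n"
    then have [simp]: "(z @ y) ! n = z ! n" "(z @ y) ! Suc n = y ! 0" "(z @ y) ! Suc (Suc n) = y ! 1"
      for y by (auto simp: nth_append)
    have "take n z \<in> Fn n" using z by (simp add: Fn_def)
    note hz = h[OF this]
    have "(\<exists>y. length y = 2 \<and> y ! 0 = f (take n z) \<and> y ! 1 = g (take n z) \<and> P [y ! 0, y ! 1, z ! n])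
        = P [f (take n z), g (take n z), z ! n]"
      by (auto intro!: exI[of _ "[f (take n z), g (take n z)]"])
    then show "(\<exists>y. length y = 2 \<and> (z @ y) ! (n + 1) = f (take n (z @ y)) \<and>
         (z @ y) ! (n + 2) = g (take n (z @ y)) \<and>
         P [(z @ y) ! (n + 1), (z @ y) ! (n + 2), (z @ y) ! n]) = (z ! n = h (take n z))"
      using z hz by simp
  qed
qed

lemma definable_fun_const: "definable_fun S n (\<lambda>_. c)"
  unfolding definable_fun_iff by (rule dset_const) simp

lemma definable_fun_add:
  "definable_fun S n f \<Longrightarrow> definable_fun S n g \<Longrightarrow> definable_fun S n (\<lambda>x. f x + g x)"
  by (erule (1) definable_funI[where P = "\<lambda>w. w ! 2 = w ! 0 + w ! 1"]) (auto intro: dset_add)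

lemma definable_fun_mult:
  "definable_fun S n f \<Longrightarrow> definable_fun S n g \<Longrightarrow> definable_fun S n (\<lambda>x. f x * g x)"
  by (erule (1) definable_funI[where P = "\<lambda>w. w ! 2 = w ! 0 * w ! 1"]) (auto intro: dset_mult)

lemma definable_fun_inverse:
  assumes f: "definable_fun S n f" and nz: "\<And>x. x \<in> Fn n \<Longrightarrow> f x \<noteq> 0"
  shows "definable_fun S n (\<lambda>x. inverse (f x))"
proof (rule definable_funI[OF f definable_fun_const, where P = "\<lambda>w. w ! 1 = w ! 0 * w ! 2"])
  show "([f x, 1, z] ! 1 = [f x, 1, z] ! 0 * [f x, 1, z] ! 2) \<longleftrightarrow> z = inverse (f x)"
    if "x \<in> Fn n" for x z
    using nz[OF that] by (auto simp: field_simps)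
qed (auto intro: dset_mult)

end

text \<open>The root is the supremum of the definable set of all x with x * x \<le> a; if its square
  differed from a in either direction, it would fail to be the least upper bound.\<close>

lemma def_complete_imp_sqrt:
  fixes S :: "nat \<Rightarrow> 'a::linordered_field list set set"
  assumes S: "dstructure S" "def_complete S" and a: "0 \<le> (a :: 'a)"
  shows "\<exists>s\<ge>0. s * s = a"
proof -
  interpret definable_family S by unfold_locales fact
  define X where "X = {x \<in> Fn 1. \<exists>y. y = x ! 0 * x ! 0 \<and> \<not> a < y}"
  \<comment> \<open>Two auxiliary coordinates are adjoined, one for the square of x and one for the
    parameter \<open>a\<close>, because the atomic rules only compare coordinates. Both are then
    quantified away.\<close>
  have "dset (Suc 1) (\<lambda>x. \<exists>y. (x @ [y]) ! 1 = (x @ [y]) ! 0 * (x @ [y]) ! 0 \<and>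
      (x @ [y]) ! 2 = a \<and> \<not> (x @ [y]) ! 2 < (x @ [y]) ! 1)"
    by (intro dset_Ex dset_conj dset_not dset_mult dset_const dset_less) auto
  from dset_Ex[OF this] have "dset 1 (\<lambda>x. \<exists>y. y = x ! 0 * x ! 0 \<and> \<not> a < y)"
    by (rule dset_cong) (auto simp: nth_append)
  then have X: "X \<in> S 1" by (simp add: X_def dset_def)
  have pts: "x \<in> pts X \<longleftrightarrow> x * x \<le> a" for x
    by (auto simp: pts_def X_def Fn_def not_less)
  have bdd: "x \<le> 1 + a" if "x * x \<le> a" for x
  proof (rule ccontr)
    assume "\<not> ?thesis"
    then have "(1 + a) * (1 + a) \<le> x * x" using a by (intro mult_mono) auto
    moreover have "a < (1 + a) * (1 + a)" using a by (simp add: algebra_simps add_pos_nonneg)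
    ultimately show False using that by simp
  qed
  have "0 \<in> pts X" using a by (simp add: pts)
  then obtain s where s: "\<And>x. x \<in> pts X \<Longrightarrow> x \<le> s"
    and least: "\<And>b. (\<And>x. x \<in> pts X \<Longrightarrow> x \<le> b) \<Longrightarrow> s \<le> b"
    using S(2) X bdd pts unfolding def_complete_def by (metis empty_iff)
  have s0: "0 \<le> s" using s \<open>0 \<in> pts X\<close> by blast
  have "\<not> s * s < a"
  proof
    assume lt: "s * s < a"
    \<comment> \<open>Since d \<le> 1, the increment 2sd + d^2 of the square is at most d(2s + 1),
      hence at most a - s^2. So \<open>s + d\<close> still lies in the set although it exceeds
      \<open>s\<close>.\<close>
    define d where "d = min 1 ((a - s * s) / (2 * s + 1))"
    have d: "0 < d" "d \<le> 1" using lt s0 by (auto simp: d_def add_nonneg_pos)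
    have "d * (2 * s + 1) \<le> (a - s * s) / (2 * s + 1) * (2 * s + 1)"
      using s0 by (intro mult_right_mono) (auto simp: d_def)
    also have "\<dots> = a - s * s" using s0 by (simp add: add_nonneg_eq_0_iff)
    finally have "d * (2 * s + 1) \<le> a - s * s" .
    moreover have "d * d \<le> d" using d by (simp add: mult_left_le)
    ultimately have "(s + d) * (s + d) \<le> a" by (simp add: algebra_simps)
    then show False using s[of "s + d"] d by (simp add: pts)
  qed
  moreover have "\<not> a < s * s"
  proof
    assume lt: "a < s * s"
    then have sp: "0 < s" using s0 a by (cases "s = 0") auto
    \<comment> \<open>This is the Newton step: the square of \<open>s - d\<close> equals a + d^2 >
      a, so \<open>s - d\<close> is a smaller upper bound.\<close>
    define d where "d = (s * s - a) / (2 * s)"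
    have d: "0 < d" "2 * s * d = s * s - a" using lt sp by (auto simp: d_def)
    have "0 \<le> s - d"
    proof -
      have "s * s - a \<le> s * (2 * s)" using a by (simp add: algebra_simps)
      then show ?thesis using sp by (simp add: d_def divide_le_eq)
    qed
    have "a < (s - d) * (s - d)" using d by (simp add: algebra_simps)
    have "s \<le> s - d"
    proof (rule least, rule ccontr)
      fix x assume "x \<in> pts X" "\<not> x \<le> s - d"
      then have "(s - d) * (s - d) \<le> x * x" "x * x \<le> a"
        using \<open>0 \<le> s - d\<close> by (auto intro!: mult_mono simp: pts)
      with \<open>a < (s - d) * (s - d)\<close> show False by simp
    qed
    with d show False by simp
  qed
  ultimately have "s * s = a" by simp
  with s0 show ?thesis by blast
qed

section \<open>Limits and differentiability over an ordered field\<close>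

text \<open>Stating convergence for an arbitrary filter lets one set of limit rules serve both
  continuity on F^n and limits of difference quotients.\<close>

definition tends :: "('b \<Rightarrow> 'a::linordered_field) \<Rightarrow> 'a \<Rightarrow> 'b filter \<Rightarrow> bool" where
  "tends f l F \<longleftrightarrow> (\<forall>e>0. \<forall>\<^sub>F t in F. \<bar>f t - l\<bar> < e)"

lemma tendsD: "tends f l F \<Longrightarrow> 0 < e \<Longrightarrow> \<forall>\<^sub>F t in F. \<bar>f t - l\<bar> < e"
  by (simp add: tends_def)

lemma tends_const: "tends (\<lambda>_. c) c F"
  by (simp add: tends_def)

lemma tends_cong:
  fixes l :: "'a::linordered_field"
  assumes "tends f l F" "\<forall>\<^sub>F t in F. f t = g t"
  shows "tends g l F"
  unfolding tends_def
proof (intro allI impI)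
  fix e :: 'a assume "0 < e"
  from tendsD[OF assms(1) this] assms(2) show "\<forall>\<^sub>F t in F. \<bar>g t - l\<bar> < e"
    by eventually_elim simp
qed

lemma tends_add:
  fixes l :: "'a::linordered_field"
  assumes "tends f l F" "tends g m F"
  shows "tends (\<lambda>t. f t + g t) (l + m) F"
  unfolding tends_def
proof (intro allI impI)
  fix e :: 'a assume "0 < e"
  then have "0 < e / 2" by simp
  from tendsD[OF assms(1) this] tendsD[OF assms(2) this]
  show "\<forall>\<^sub>F t in F. \<bar>f t + g t - (l + m)\<bar> < e"
  proof eventually_elim
    case (elim t)
    have "\<bar>f t + g t - (l + m)\<bar> \<le> \<bar>f t - l\<bar> + \<bar>g t - m\<bar>" by linarith
    also have "\<dots> < e / 2 + e / 2" using elim by (rule add_strict_mono)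
    finally show ?case by simp
  qed
qed

lemma tends_mult:
  fixes l :: "'a::linordered_field"
  assumes "tends f l F" "tends g m F"
  shows "tends (\<lambda>t. f t * g t) (l * m) F"
  unfolding tends_def
proof (intro allI impI)
  fix e :: 'a assume e: "0 < e"
  \<comment> \<open>With both errors below d \<le> 1, the product of the errors is below d and the
    two mixed terms are at most \<bar>l\<bar> d and \<bar>m\<bar> d, which adds up to d c \<le>
    e.\<close>
  define c where "c = 1 + \<bar>l\<bar> + \<bar>m\<bar>"
  have c: "0 < c" by (simp add: c_def add_pos_nonneg)
  define d where "d = min 1 (e / c)"
  have d: "0 < d" "d \<le> 1" "d * c \<le> e"
    using e c by (auto simp: d_def min_def field_simps)
  from tendsD[OF assms(1) d(1)] tendsD[OF assms(2) d(1)]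
  show "\<forall>\<^sub>F t in F. \<bar>f t * g t - l * m\<bar> < e"
  proof eventually_elim
    case (elim t)
    have "f t * g t - l * m = (f t - l) * (g t - m) + (l * (g t - m) + m * (f t - l))"
      by (simp add: algebra_simps)
    then have "\<bar>f t * g t - l * m\<bar> \<le> \<bar>f t - l\<bar> * \<bar>g t - m\<bar> + (\<bar>l\<bar> * \<bar>g t - m\<bar> + \<bar>m\<bar> * \<bar>f t - l\<bar>)"
      by (metis (no_types, lifting) abs_mult abs_triangle_ineq add_left_mono order_trans)
    also have "\<dots> < d * 1 + (\<bar>l\<bar> * d + \<bar>m\<bar> * d)"
    proof (rule add_less_le_mono)
      show "\<bar>f t - l\<bar> * \<bar>g t - m\<bar> < d * 1"
        using elim d by (intro mult_strict_mono') auto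
      show "\<bar>l\<bar> * \<bar>g t - m\<bar> + \<bar>m\<bar> * \<bar>f t - l\<bar> \<le> \<bar>l\<bar> * d + \<bar>m\<bar> * d"
        using elim by (intro add_mono mult_left_mono) auto
    qed
    also have "\<dots> = d * c" by (simp add: c_def algebra_simps)
    finally show ?case using d by simp
  qed
qed

lemma tends_cmult: "tends f l F \<Longrightarrow> tends (\<lambda>t. c * f t) (c * l) F"
  by (rule tends_mult[OF tends_const])

lemma tends_power: "tends f l F \<Longrightarrow> tends (\<lambda>t. f t ^ m) (l ^ m) F"
  by (induction m) (auto intro: tends_const tends_mult)

lemma tends_nonzero:
  assumes "tends f l F" "l \<noteq> 0"
  shows "\<forall>\<^sub>F t in F. \<bar>l\<bar> / 2 < \<bar>f t\<bar>"
proof -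
  have "0 < \<bar>l\<bar> / 2" using assms(2) by simp
  from tendsD[OF assms(1) this] show ?thesis
    by eventually_elim (auto simp: abs_if split: if_splits; linarith)
qed

lemma tends_inverse:
  fixes l :: "'a::linordered_field"
  assumes "tends f l F" "l \<noteq> 0"
  shows "tends (\<lambda>t. inverse (f t)) (inverse l) F"
  unfolding tends_def
proof (intro allI impI)
  fix e :: 'a assume e: "0 < e"
  \<comment> \<open>The difference of the inverses is (l - f t) / (f t * l). Eventually \<bar>f
    t\<bar> exceeds \<bar>l\<bar> / 2, so this tolerance on the numerator brings the quotient below
    e.\<close>
  then have "0 < e * (\<bar>l\<bar> / 2 * \<bar>l\<bar>)" using assms(2) by (intro mult_pos_pos) auto
  from tendsD[OF assms(1) this] tends_nonzero[OF assms]
  show "\<forall>\<^sub>F t in F. \<bar>inverse (f t) - inverse l\<bar> < e"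
  proof eventually_elim
    case (elim t)
    then have nz: "f t \<noteq> 0" using assms(2) by (auto simp: field_simps)
    have "\<bar>f t - l\<bar> < e * (\<bar>l\<bar> / 2 * \<bar>l\<bar>)" by fact
    also have "\<dots> \<le> e * (\<bar>f t\<bar> * \<bar>l\<bar>)"
      using elim e by (intro mult_left_mono mult_right_mono) auto
    finally have "\<bar>f t - l\<bar> / (\<bar>f t\<bar> * \<bar>l\<bar>) < e"
      using nz assms(2) by (simp add: divide_less_eq)
    moreover have "inverse (f t) - inverse l = (l - f t) / (f t * l)"
      using nz assms(2) by (simp add: field_simps)
    ultimately show ?case by (simp add: abs_mult abs_minus_commute)
  qed
qed

text \<open>Punctured neighbourhoods, because difference quotients divide by t; the filter
  \<open>nhds_Fn\<close> below keeps its centre. In both cases the generating sets are closed under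
  taking the smaller radius, so "eventually" unfolds to the usual delta condition.\<close>

definition at_zero :: "'a::linordered_field filter" where
  "at_zero = (INF d\<in>{0<..}. principal {t. t \<noteq> 0 \<and> \<bar>t\<bar> < d})"

definition nhds_Fn :: "nat \<Rightarrow> 'a::linordered_field list \<Rightarrow> 'a list filter" where
  "nhds_Fn n x = (INF d\<in>{0<..}. principal {y \<in> Fn n. \<forall>i<n. \<bar>y ! i - x ! i\<bar> < d})"

lemma eventually_at_zero:
  "eventually P at_zero \<longleftrightarrow> (\<exists>d>0. \<forall>t. t \<noteq> 0 \<and> \<bar>t\<bar> < d \<longrightarrow> P t)"
  unfolding at_zero_def
proof (subst eventually_INF_base)
  show "\<exists>x\<in>{0<..}. principal {t. t \<noteq> 0 \<and> \<bar>t\<bar> < x}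
      \<le> inf (principal {t. t \<noteq> 0 \<and> \<bar>t\<bar> < a}) (principal {t. t \<noteq> 0 \<and> \<bar>t\<bar> < b})"
    if "a \<in> {0<..}" "b \<in> {0<..}" for a b :: 'a
    using that by (intro bexI[of _ "min a b"]) auto
qed (auto simp: eventually_principal intro: exI[of _ 1])

lemma eventually_nhds_Fn:
  "eventually P (nhds_Fn n x)
    \<longleftrightarrow> (\<exists>d>0. \<forall>y\<in>Fn n. (\<forall>i<n. \<bar>y ! i - x ! i\<bar> < d) \<longrightarrow> P y)"
  unfolding nhds_Fn_def
proof (subst eventually_INF_base)
  show "\<exists>c\<in>{0<..}. principal {y \<in> Fn n. \<forall>i<n. \<bar>y ! i - x ! i\<bar> < c}
      \<le> inf (principal {y \<in> Fn n. \<forall>i<n. \<bar>y ! i - x ! i\<bar> < a})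
            (principal {y \<in> Fn n. \<forall>i<n. \<bar>y ! i - x ! i\<bar> < b})"
    if "a \<in> {0<..}" "b \<in> {0<..}" for a b :: 'a
    using that by (intro bexI[of _ "min a b"]) auto
qed (auto simp: eventually_principal intro: exI[of _ 1])

lemma cont_Fn_iff: "cont_Fn n f \<longleftrightarrow> (\<forall>x\<in>Fn n. tends f (f x) (nhds_Fn n x))"
  by (simp add: cont_Fn_def tends_def eventually_nhds_Fn)

lemma has_pderiv_iff:
  "has_pderiv i f x L \<longleftrightarrow> tends (\<lambda>t. (f (x[i := x ! i + t]) - f x) / t) L at_zero"
  by (simp add: has_pderiv_def tends_def eventually_at_zero)

lemma at_zero_nonzero: "\<forall>\<^sub>F t in at_zero. t \<noteq> (0::'a::linordered_field)"
  unfolding eventually_at_zero by (intro exI[of _ 1]) simp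

lemma tends_at_zero: "tends (\<lambda>t. t) 0 at_zero"
  by (auto simp: tends_def eventually_at_zero)

text \<open>Multiplying the difference quotient by t and adding f x recovers the function for t
  \<noteq> 0. This gives continuity along the i-th coordinate line, which the product, inverse and
  root rules need.\<close>

lemma has_pderiv_imp_tends:
  assumes "has_pderiv i f x L"
  shows "tends (\<lambda>t. f (x[i := x ! i + t])) (f x) at_zero"
proof -
  have "tends (\<lambda>t. (f (x[i := x ! i + t]) - f x) / t * t + f x) (L * 0 + f x) at_zero"
    using assms unfolding has_pderiv_iff by (intro tends_add tends_mult tends_at_zero tends_const)
  then have "tends (\<lambda>t. (f (x[i := x ! i + t]) - f x) / t * t + f x) (f x) at_zero"
    by simp
  then show ?thesis
    by (rule tends_cong) (use at_zero_nonzero in eventually_elim, simp)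
qed

section \<open>Differentiation rules\<close>

lemma has_pderiv_const: "has_pderiv i (\<lambda>_. c) x 0"
  by (simp add: has_pderiv_iff tends_const)

lemma has_pderiv_add:
  assumes "has_pderiv i f x L" "has_pderiv i g x M"
  shows "has_pderiv i (\<lambda>x. f x + g x) x (L + M)"
  using tends_add[OF assms[unfolded has_pderiv_iff]] unfolding has_pderiv_iff
  by (simp add: add_divide_distrib[symmetric] algebra_simps)

lemma has_pderiv_mult:
  assumes f: "has_pderiv i f x L" and g: "has_pderiv i g x M"
  shows "has_pderiv i (\<lambda>x. f x * g x) x (L * g x + f x * M)"
proof -
  have "tends (\<lambda>t. (f (x[i := x ! i + t]) - f x) / t * g (x[i := x ! i + t])
      + f x * ((g (x[i := x ! i + t]) - g x) / t)) (L * g x + f x * M) at_zero"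
    using f g has_pderiv_imp_tends[OF g] unfolding has_pderiv_iff
    by (intro tends_add tends_mult tends_cmult)
  then show ?thesis
    unfolding has_pderiv_iff
    by (rule tends_cong) (use at_zero_nonzero in eventually_elim, simp add: field_simps)
qed

lemma has_pderiv_power:
  assumes f: "has_pderiv i f x L"
  shows "has_pderiv i (\<lambda>x. f x ^ m) x (of_nat m * f x ^ (m - 1) * L)"
proof (induction m)
  case 0
  show ?case by (simp add: has_pderiv_const)
next
  case (Suc m)
  from has_pderiv_mult[OF f Suc.IH] show ?case
    by (cases m) (simp_all add: algebra_simps)
qed

text \<open>The derivative is written as a product with the constant -1 so that
  \<open>Cr_mult\<close> and \<open>Cr_const\<close> apply to it directly.\<close>

lemma has_pderiv_inverse:
  assumes f: "has_pderiv i f x L" and nz: "f x \<noteq> 0"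
  shows "has_pderiv i (\<lambda>x. inverse (f x)) x (- 1 * (L * (inverse (f x) * inverse (f x))))"
proof -
  note lim = has_pderiv_imp_tends[OF f]
  have "tends (\<lambda>t. - 1 * ((f (x[i := x ! i + t]) - f x) / t
      * (inverse (f (x[i := x ! i + t])) * inverse (f x))))
     (- 1 * (L * (inverse (f x) * inverse (f x)))) at_zero"
    using f tends_inverse[OF lim nz] unfolding has_pderiv_iff
    by (intro tends_cmult tends_mult tends_const)
  moreover have "\<forall>\<^sub>F t in at_zero. - 1 * ((f (x[i := x ! i + t]) - f x) / t
      * (inverse (f (x[i := x ! i + t])) * inverse (f x)))
      = (inverse (f (x[i := x ! i + t])) - inverse (f x)) / t"
    using at_zero_nonzero tends_nonzero[OF lim nz]
  proof eventually_elim
    case (elim t)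
    then have "f (x[i := x ! i + t]) \<noteq> 0" using nz by (auto simp: field_simps)
    with elim nz show ?case by (simp add: field_simps)
  qed
  ultimately show ?thesis unfolding has_pderiv_iff by (rule tends_cong)
qed

section \<open>Functions of class C^r\<close>

lemma Cr_imp_cont: "Cr r n f \<Longrightarrow> cont_Fn n f"
  by (cases r) auto

lemma Cr_Suc_imp: "Cr (Suc r) n f \<Longrightarrow> Cr r n f"
proof (induction r arbitrary: f)
  case 0
  then show ?case by simp
next
  case (Suc r)
  show ?case
    unfolding Cr.simps
  proof (intro conjI allI impI)
    show "cont_Fn n f" using Suc.prems by (rule Cr_imp_cont)
    fix i assume "i < n"
    then obtain D where "\<forall>x\<in>Fn n. has_pderiv i f x (D x)" "Cr (Suc r) n D"
      using Suc.prems unfolding Cr.simps(2)[of "Suc r"] by blast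
    with Suc.IH show "\<exists>D. (\<forall>x\<in>Fn n. has_pderiv i f x (D x)) \<and> Cr r n D" by blast
  qed
qed

lemma Cr_SucE:
  assumes "Cr (Suc r) n f" "i < n"
  obtains D where "\<And>x. x \<in> Fn n \<Longrightarrow> has_pderiv i f x (D x)" "Cr r n D"
  using assms unfolding Cr.simps by blast

lemma Cr_SucI:
  assumes "cont_Fn n f"
    and "\<And>i. i < n \<Longrightarrow> \<exists>D. (\<forall>x\<in>Fn n. has_pderiv i f x (D x)) \<and> Cr r n D"
  shows "Cr (Suc r) n f"
  using assms by simp

lemma Cr_const: "Cr r n (\<lambda>_. c)"
proof (induction r arbitrary: c)
  case 0
  show ?case by (simp add: cont_Fn_iff tends_const)
next
  case (Suc r)
  then show ?case
    by (intro Cr_SucI) (auto simp: cont_Fn_iff tends_const intro: has_pderiv_const)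
qed

lemma Cr_add: "Cr r n f \<Longrightarrow> Cr r n g \<Longrightarrow> Cr r n (\<lambda>x. f x + g x)"
proof (induction r arbitrary: f g)
  case 0
  then show ?case by (simp add: cont_Fn_iff tends_add)
next
  case (Suc r)
  show ?case
  proof (rule Cr_SucI)
    show "cont_Fn n (\<lambda>x. f x + g x)"
      using Suc.prems[THEN Cr_imp_cont] by (simp add: cont_Fn_iff tends_add)
    fix i assume i: "i < n"
    obtain D where "\<And>x. x \<in> Fn n \<Longrightarrow> has_pderiv i f x (D x)" "Cr r n D"
      using Cr_SucE[OF Suc.prems(1) i] by blast
    moreover obtain E where "\<And>x. x \<in> Fn n \<Longrightarrow> has_pderiv i g x (E x)" "Cr r n E"
      using Cr_SucE[OF Suc.prems(2) i] by blast
    ultimately show "\<exists>D. (\<forall>x\<in>Fn n. has_pderiv i (\<lambda>x. f x + g x) x (D x)) \<and> Cr r n D"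
      by (intro exI[of _ "\<lambda>x. D x + E x"]) (auto intro: has_pderiv_add Suc.IH)
  qed
qed

lemma Cr_mult: "Cr r n f \<Longrightarrow> Cr r n g \<Longrightarrow> Cr r n (\<lambda>x. f x * g x)"
proof (induction r arbitrary: f g)
  case 0
  then show ?case by (simp add: cont_Fn_iff tends_mult)
next
  case (Suc r)
  \<comment> \<open>The derivative given by the product rule contains f and g themselves, so they
    are also needed one class lower.\<close>
  note fg = Suc.prems[THEN Cr_Suc_imp]
  show ?case
  proof (rule Cr_SucI)
    show "cont_Fn n (\<lambda>x. f x * g x)"
      using Suc.prems[THEN Cr_imp_cont] by (simp add: cont_Fn_iff tends_mult)
    fix i assume i: "i < n"
    obtain D where "\<And>x. x \<in> Fn n \<Longrightarrow> has_pderiv i f x (D x)" "Cr r n D"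
      using Cr_SucE[OF Suc.prems(1) i] by blast
    moreover obtain E where "\<And>x. x \<in> Fn n \<Longrightarrow> has_pderiv i g x (E x)" "Cr r n E"
      using Cr_SucE[OF Suc.prems(2) i] by blast
    ultimately show "\<exists>D. (\<forall>x\<in>Fn n. has_pderiv i (\<lambda>x. f x * g x) x (D x)) \<and> Cr r n D"
      using fg by (intro exI[of _ "\<lambda>x. D x * g x + f x * E x"])
        (auto intro!: has_pderiv_mult Cr_add Suc.IH)
  qed
qed

lemma Cr_inverse:
  "Cr r n f \<Longrightarrow> (\<And>x. x \<in> Fn n \<Longrightarrow> f x \<noteq> 0) \<Longrightarrow> Cr r n (\<lambda>x. inverse (f x))"
proof (induction r)
  case 0
  then show ?case by (simp add: cont_Fn_iff tends_inverse)
next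
  case (Suc r)
  \<comment> \<open>The derivative contains the inverse itself, whose class C^r is the induction
    hypothesis.\<close>
  note inv = Suc.IH[OF Cr_Suc_imp[OF Suc.prems(1)] Suc.prems(2)]
  show ?case
  proof (rule Cr_SucI)
    show "cont_Fn n (\<lambda>x. inverse (f x))"
      using Suc.prems(2) Cr_imp_cont[OF Suc.prems(1)] by (simp add: cont_Fn_iff tends_inverse)
    fix i assume i: "i < n"
    obtain D where "\<And>x. x \<in> Fn n \<Longrightarrow> has_pderiv i f x (D x)" "Cr r n D"
      using Cr_SucE[OF Suc.prems(1) i] by blast
    then show "\<exists>D. (\<forall>x\<in>Fn n. has_pderiv i (\<lambda>x. inverse (f x)) x (D x)) \<and> Cr r n D"
      using inv Suc.prems(2)
      by (intro exI[of _ "\<lambda>x. - 1 * (D x * (inverse (f x) * inverse (f x)))"])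
        (intro conjI ballI has_pderiv_inverse Cr_mult Cr_const; simp)
  qed
qed

section \<open>Powers of the square root of the positive part\<close>

locale pos_sqrt =
  fixes rt :: "'a::linordered_field \<Rightarrow> 'a"
  assumes rt_nonneg: "0 \<le> rt a" and rt_mult_self: "rt a * rt a = max 0 a"
begin

lemma rt_eq_0: "a \<le> 0 \<Longrightarrow> rt a = 0"
  using rt_mult_self[of a] by simp

lemma rt_pos: "0 < a \<Longrightarrow> 0 < rt a"
  using rt_mult_self[of a] rt_nonneg[of a] by (cases "rt a = 0") auto

lemma rt_power2: "0 \<le> a \<Longrightarrow> (rt a)\<^sup>2 = a"
  using rt_mult_self[of a] by (simp add: power2_eq_square max_absorb2)

lemma rt_unique: "0 \<le> s \<Longrightarrow> s * s = max 0 a \<Longrightarrow> s = rt a"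
  using rt_mult_self[of a] rt_nonneg[of a] square_eq_iff[of s "rt a"] by fastforce

text \<open>One factor \<bar>rt a - rt b\<bar> is bounded by rt a + rt b, which leaves a difference
  of squares. This Hoelder estimate of exponent 1/2 gives continuity of \<open>rt\<close>, also at
  0.\<close>

lemma rt_diff_square: "(rt a - rt b) * (rt a - rt b) \<le> \<bar>a - b\<bar>"
proof -
  have "\<bar>rt a - rt b\<bar> * \<bar>rt a - rt b\<bar> \<le> \<bar>rt a - rt b\<bar> * (rt a + rt b)"
    using rt_nonneg[of a] rt_nonneg[of b] by (intro mult_left_mono) auto
  also have "\<dots> = \<bar>rt a - rt b\<bar> * \<bar>rt a + rt b\<bar>"
    using rt_nonneg[of a] rt_nonneg[of b] by simp
  also have "\<dots> = \<bar>rt a * rt a - rt b * rt b\<bar>"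
    by (simp add: abs_mult[symmetric] algebra_simps)
  also have "\<dots> \<le> \<bar>a - b\<bar>"
    unfolding rt_mult_self by (auto simp: max_def)
  finally show ?thesis by (simp add: abs_mult[symmetric])
qed

lemma tends_rt:
  assumes "tends f l F"
  shows "tends (\<lambda>t. rt (f t)) (rt l) F"
  unfolding tends_def
proof (intro allI impI)
  fix e :: 'a assume e: "0 < e"
  then have "0 < e * e" by simp
  from tendsD[OF assms this] show "\<forall>\<^sub>F t in F. \<bar>rt (f t) - rt l\<bar> < e"
  proof eventually_elim
    case (elim t)
    have "\<bar>rt (f t) - rt l\<bar> * \<bar>rt (f t) - rt l\<bar> < e * e"
      using rt_diff_square[of "f t" l] elim by (simp add: abs_mult[symmetric])
    then show ?case using e by (meson abs_ge_zero mult_mono not_le less_imp_le)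
  qed
qed

lemma has_pderiv_rt:
  assumes f: "has_pderiv i f x L" and pos: "0 < f x"
  shows "has_pderiv i (\<lambda>x. rt (f x)) x (L * inverse (rt (f x) + rt (f x)))"
proof -
  let ?f = "\<lambda>t. f (x[i := x ! i + t])"
  note lim = has_pderiv_imp_tends[OF f]
  have p: "0 < rt (f x)" using pos by (rule rt_pos)
  have "tends (\<lambda>t. (?f t - f x) / t * inverse (rt (?f t) + rt (f x)))
      (L * inverse (rt (f x) + rt (f x))) at_zero"
    \<comment> \<open>The difference of roots is rationalised by rt (f (x + t)) + rt (f x), whose
      limit is positive because f x > 0.\<close>
    using f p unfolding has_pderiv_iff
    by (intro tends_mult tends_inverse tends_add tends_const tends_rt lim) auto
  moreover have "\<forall>\<^sub>F t in at_zero. (?f t - f x) / t * inverse (rt (?f t) + rt (f x))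
      = (rt (?f t) - rt (f x)) / t"
    using tendsD[OF lim pos]
  proof eventually_elim
    case (elim t)
    then have "0 < ?f t" by (simp add: abs_if split: if_splits)
    then have "?f t - f x = (rt (?f t) - rt (f x)) * (rt (?f t) + rt (f x))"
      using rt_mult_self[of "?f t"] rt_mult_self[of "f x"] pos by (simp add: algebra_simps)
    moreover have "rt (?f t) + rt (f x) \<noteq> 0" using p rt_nonneg[of "?f t"] by simp
    ultimately show ?case by simp
  qed
  ultimately show ?thesis unfolding has_pderiv_iff by (rule tends_cong)
qed

text \<open>Where f is negative the power vanishes nearby; where f is positive the chain rule
  applies. At a zero of f the quotient is (f / t) times the remaining power of exponent m + 1, which
  tends to L * 0 because m + 1 is positive. Differentiation thus lowers the exponent of the root by
  two.\<close>

lemma has_pderiv_rt_power: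
  assumes f: "has_pderiv i f x L"
  shows "has_pderiv i (\<lambda>x. rt (f x) ^ (m + 3)) x (of_nat (m + 3) / 2 * (rt (f x) ^ (m + 1) * L))"
proof -
  let ?f = "\<lambda>t. f (x[i := x ! i + t])"
  note lim = has_pderiv_imp_tends[OF f]
  consider "f x < 0" | "f x = 0" | "0 < f x" by (rule linorder_cases)
  then show ?thesis
  proof cases
    case 1
    then have "0 < - f x" by simp
    from tendsD[OF lim this]
    have "\<forall>\<^sub>F t in at_zero. 0 = (rt (?f t) ^ (m + 3) - rt (f x) ^ (m + 3)) / t"
    proof eventually_elim
      case (elim t)
      then have "?f t < 0" by (simp add: abs_if split: if_splits)
      with 1 show ?case by (simp add: rt_eq_0)
    qed
    from tends_cong[OF tends_const this] show ?thesis
      using 1 by (simp add: has_pderiv_iff rt_eq_0)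
  next
    case 2
    have "tends (\<lambda>t. (?f t - f x) / t * rt (?f t) ^ (m + 1)) (L * rt (f x) ^ (m + 1)) at_zero"
      using f unfolding has_pderiv_iff by (intro tends_mult tends_power tends_rt lim)
    then have *: "tends (\<lambda>t. ?f t / t * rt (?f t) ^ (m + 1)) 0 at_zero"
      using 2 by (simp add: rt_eq_0)
    have eq: "?f t / t * rt (?f t) ^ (m + 1) = rt (?f t) ^ (m + 3) / t" for t
    proof (cases "0 < ?f t")
      case True
      then have "?f t = rt (?f t) * rt (?f t)" using rt_mult_self[of "?f t"] by simp
      then have "?f t / t * rt (?f t) ^ (m + 1) = rt (?f t) * rt (?f t) / t * rt (?f t) ^ (m + 1)"
        by (rule arg_cong)
      then show ?thesis by (simp add: numeral_3_eq_3 algebra_simps)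
    qed (simp add: rt_eq_0)
    have "tends (\<lambda>t. rt (?f t) ^ (m + 3) / t) 0 at_zero"
      by (rule tends_cong[OF *]) (use eq in simp)
    then show ?thesis using 2 by (simp add: has_pderiv_iff rt_eq_0 zero_power)
  next
    case 3
    have p: "0 < rt (f x)" using 3 by (rule rt_pos)
    have "of_nat (m + 3) * rt (f x) ^ (m + 3 - 1) * (L * inverse (rt (f x) + rt (f x)))
        = of_nat (m + 3) / 2 * (rt (f x) ^ (m + 1) * L)"
      using p by (simp add: field_simps)
    with has_pderiv_power[OF has_pderiv_rt[OF f 3], of "m + 3"] show ?thesis by metis
  qed
qed

lemma Cr_rt_power:
  "Cr r n f \<Longrightarrow> 2 * r + 1 \<le> l \<Longrightarrow> Cr r n (\<lambda>x. rt (f x) ^ l)"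
proof (induction r arbitrary: l)
  case 0
  then show ?case by (simp add: cont_Fn_iff tends_power tends_rt)
next
  case (Suc r)
  \<comment> \<open>Here l \<ge> 2r + 3, so the subtraction does not truncate, and the exponent m +
    1 = l - 2 of the derivative still meets the bound for class C^r.\<close>
  define m where "m = l - 3"
  have l: "l = m + 3" and m: "2 * r + 1 \<le> m + 1" using Suc.prems(2) by (auto simp: m_def)
  note rt = Suc.IH[OF Cr_Suc_imp[OF Suc.prems(1)] m]
  show ?case
    unfolding l
  proof (rule Cr_SucI)
    show "cont_Fn n (\<lambda>x. rt (f x) ^ (m + 3))"
      using Cr_imp_cont[OF Suc.prems(1)] unfolding cont_Fn_iff by (intro ballI tends_power tends_rt) auto
    fix i assume i: "i < n"
    obtain D where "\<And>x. x \<in> Fn n \<Longrightarrow> has_pderiv i f x (D x)" "Cr r n D"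
      using Cr_SucE[OF Suc.prems(1) i] by blast
    then show "\<exists>D. (\<forall>x\<in>Fn n. has_pderiv i (\<lambda>x. rt (f x) ^ (m + 3)) x (D x)) \<and> Cr r n D"
      using rt by (intro exI[of _ "\<lambda>x. of_nat (m + 3) / 2 * (rt (f x) ^ (m + 1) * D x)"])
        (intro conjI ballI has_pderiv_rt_power Cr_mult Cr_const; simp)
  qed
qed

end

section \<open>The certificates\<close>

locale definable_sqrt = definable_family S + pos_sqrt rt
  for S :: "nat \<Rightarrow> 'a::linordered_field list set set" and rt :: "'a \<Rightarrow> 'a"
begin

lemma definable_fun_rt:
  assumes f: "definable_fun S n f"
  shows "definable_fun S n (\<lambda>x. rt (f x))"
proof (rule definable_funI[OF f definable_fun_const])
  \<comment> \<open>Coordinate 1 carries the constant 0. The formula says that z is nonnegative and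
    that either z squared is the argument, or z is 0 and the argument is not positive.\<close>
  let ?P = "\<lambda>w::'a list. \<not> w ! 2 < w ! 1 \<and>
    (w ! 0 = w ! 2 * w ! 2 \<or> (w ! 2 = w ! 1 \<and> \<not> w ! 1 < w ! 0))"
  show "dset 3 ?P"
    by (intro dset_conj dset_disj dset_not dset_less dset_mult dset_eq) auto
  show "?P [f x, 0, z] \<longleftrightarrow> z = rt (f x)" for x z
  proof
    assume P: "?P [f x, 0, z]"
    then have "0 \<le> z" by simp
    moreover have "z * z = max 0 (f x)" using P by (auto simp: max_def)
    ultimately show "z = rt (f x)" by (rule rt_unique)
  next
    assume z: "z = rt (f x)"
    show "?P [f x, 0, z]"
      using rt_nonneg[of "f x"] rt_mult_self[of "f x"] rt_eq_0[of "f x"]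
      by (cases "0 < f x") (auto simp: z)
  qed
qed

section \<open>Closure properties of D^r functions\<close>

lemma Dr_const: "Dr S r n (\<lambda>_. c)"
  by (simp add: Dr_def definable_fun_const Cr_const)

lemma Dr_add: "Dr S r n f \<Longrightarrow> Dr S r n g \<Longrightarrow> Dr S r n (\<lambda>x. f x + g x)"
  by (simp add: Dr_def definable_fun_add Cr_add)

lemma Dr_mult: "Dr S r n f \<Longrightarrow> Dr S r n g \<Longrightarrow> Dr S r n (\<lambda>x. f x * g x)"
  by (simp add: Dr_def definable_fun_mult Cr_mult)

lemma Dr_inverse:
  "Dr S r n f \<Longrightarrow> (\<And>x. x \<in> Fn n \<Longrightarrow> f x \<noteq> 0) \<Longrightarrow> Dr S r n (\<lambda>x. inverse (f x))"
  by (simp add: Dr_def definable_fun_inverse Cr_inverse)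

lemma Dr_minus: "Dr S r n f \<Longrightarrow> Dr S r n (\<lambda>x. - f x)"
  using Dr_mult[OF Dr_const[of r n "- 1"]] by simp

lemma Dr_power: "Dr S r n f \<Longrightarrow> Dr S r n (\<lambda>x. f x ^ m)"
  by (induction m) (simp_all add: Dr_const Dr_mult)

lemma Dr_sum: "finite I \<Longrightarrow> (\<And>i. i \<in> I \<Longrightarrow> Dr S r n (f i)) \<Longrightarrow> Dr S r n (\<lambda>x. \<Sum>i\<in>I. f i x)"
  by (induction I rule: finite_induct) (simp_all add: Dr_const Dr_add)

lemma Dr_rt_power:
  assumes "Dr S r n f" "2 * r + 1 \<le> l"
  shows "Dr S r n (\<lambda>x. rt (f x) ^ l)"
proof -
  have "definable_fun S n (\<lambda>x. rt (f x) ^ l)" for l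
    using assms(1) by (induction l)
      (simp_all add: Dr_def definable_fun_const definable_fun_mult definable_fun_rt)
  with assms show ?thesis by (simp add: Dr_def Cr_rt_power)
qed

lemma Dr_rt:
  assumes f: "Dr S r n f" and pos: "\<And>x. x \<in> Fn n \<Longrightarrow> 0 < f x"
  obtains h where "Dr S r n h" "\<And>x. x \<in> Fn n \<Longrightarrow> (h x)\<^sup>2 = f x"
proof
  \<comment> \<open>On F^n this is \<open>rt (f x)\<close> itself, since the even part of the odd
    power is f^r. Written this way, it is a quotient of functions already known to be D^r, with
    nonvanishing denominator.\<close>
  let ?h = "\<lambda>x. rt (f x) ^ (2 * r + 1) * inverse (f x ^ r)"
  show "Dr S r n ?h"
    by (rule Dr_mult[OF Dr_rt_power[OF f order_refl] Dr_inverse[OF Dr_power[OF f]]])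
      (use pos in fastforce)
  fix x :: "'a list" assume "x \<in> Fn n"
  then have "0 < f x" by (rule pos)
  then have "?h x = rt (f x)"
    using rt_power2[of "f x"] by (simp add: power_mult)
  then show "(?h x)\<^sup>2 = f x"
    using rt_power2[of "f x"] \<open>0 < f x\<close> by (simp only: less_imp_le)
qed

lemma rt_power_odd: "0 \<le> a \<Longrightarrow> (rt a ^ (2 * r + 1))\<^sup>2 = a ^ (2 * r + 1)"
  using rt_power2[of a] by (metis mult.commute power_mult)

section \<open>Weights, defect and the two identities\<close>

context
  fixes r n k :: nat and f :: "nat \<Rightarrow> 'a list \<Rightarrow> 'a" and g :: "'a list \<Rightarrow> 'a"
  assumes f: "\<And>i. i \<in> {1..k} \<Longrightarrow> Dr S r n (f i)" and g: "Dr S r n g"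
begin

definition neg_wt :: "nat \<Rightarrow> 'a list \<Rightarrow> 'a" where
  "neg_wt i x = rt (- f i x) ^ (2 * r + 1)"

definition defect :: "'a list \<Rightarrow> 'a" where
  "defect x = (\<Sum>i=1..k. (neg_wt i x)\<^sup>2 * - f i x)"

text \<open>The second summand is a D^r substitute for the positive part of g. It vanishes where g
  \<le> 0, so \<open>denom\<close> coincides with \<open>defect\<close> there.\<close>

definition denom :: "'a list \<Rightarrow> 'a" where
  "denom x = defect x + rt (g x) ^ (2 * r + 1)"

lemma Dr_neg_wt: "i \<in> {1..k} \<Longrightarrow> Dr S r n (neg_wt i)"
  unfolding neg_wt_def[abs_def] by (intro Dr_rt_power Dr_minus f) auto

lemma Dr_defect: "Dr S r n defect"
  unfolding defect_def[abs_def] by (intro Dr_sum Dr_mult Dr_power Dr_minus Dr_neg_wt f) auto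

lemma Dr_denom: "Dr S r n denom"
  unfolding denom_def[abs_def] by (intro Dr_add Dr_defect Dr_rt_power g) auto

text \<open>The weight switches the term off where f_i \<ge> 0, and elsewhere - f_i is
  positive.\<close>

lemma defect_summand_nonneg: "0 \<le> (neg_wt i x)\<^sup>2 * - f i x"
  by (cases "f i x \<le> 0") (simp_all add: neg_wt_def rt_eq_0 mult_nonneg_nonpos)

lemma defect_nonneg: "0 \<le> defect x"
  unfolding defect_def by (intro sum_nonneg defect_summand_nonneg)

lemma defect_pos:
  assumes "\<not> (\<forall>i\<in>{1..k}. 0 \<le> f i x)"
  shows "0 < defect x"
proof -
  from assms obtain i where i: "i \<in> {1..k}" "f i x < 0" by auto
  then have "0 < (neg_wt i x)\<^sup>2 * - f i x"
    using rt_pos[of "- f i x"] by (simp add: neg_wt_def mult_pos_neg)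
  with i(1) show ?thesis
    unfolding defect_def by (intro sum_pos2[of _ i] defect_summand_nonneg) auto
qed

lemma denom_pos: "0 < defect x \<or> 0 < g x \<Longrightarrow> 0 < denom x"
  using defect_nonneg[of x] rt_nonneg[of "g x"] rt_pos[of "g x"]
  by (auto simp: denom_def intro: add_pos_nonneg add_nonneg_pos)

lemma sum_scaled_neg_wt: "(\<Sum>i=1..k. (b * neg_wt i x)\<^sup>2 * f i x) = - (b\<^sup>2 * defect x)"
  by (simp add: defect_def sum_distrib_left sum_negf[symmetric] power_mult_distrib mult.assoc)

lemma certificate_nonneg:
  assumes "\<forall>x\<in>{x \<in> Fn n. \<forall>i\<in>{1..k}. f i x \<ge> 0}. g x \<ge> 0"
  shows "\<exists>p v. Dr S r n p \<and> (\<forall>i\<le>k. Dr S r n (v i)) \<and>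
              (\<forall>x\<in>Fn n. p x = 0 \<longrightarrow> g x = 0) \<and>
              (\<forall>x\<in>Fn n. (p x)\<^sup>2 * g x = (v 0 x)\<^sup>2 + (\<Sum>i=1..k. (v i x)\<^sup>2 * f i x))"
proof (intro exI conjI)
  let ?l = "2 * r + 1"
  \<comment> \<open>The factor g^r turns g into the odd power g^(2r+1), which up to sign is the
    square of a D^r function. The exponent r + 1 is dictated by the region g < 0, where b^2 N
    contributes N^(2r+1) * N = N^(2r+2).\<close>
  let ?p = "\<lambda>x. g x ^ r * denom x ^ (r + 1)"
  let ?b = "\<lambda>x. rt (- g x) ^ ?l * rt (defect x) ^ ?l"
  let ?u = "\<lambda>x. rt (g x) ^ ?l * denom x ^ (r + 1)"
  let ?v = "\<lambda>i. if i = 0 then ?u else (\<lambda>x. ?b x * neg_wt i x)"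
  show "Dr S r n ?p" by (intro Dr_mult Dr_power g Dr_denom)
  have "Dr S r n ?u"
    by (rule Dr_mult[OF Dr_rt_power[OF g order_refl] Dr_power[OF Dr_denom]])
  moreover have "Dr S r n ?b"
    by (rule Dr_mult[OF Dr_rt_power[OF Dr_minus[OF g] order_refl]
          Dr_rt_power[OF Dr_defect order_refl]])
  ultimately show "\<forall>i\<le>k. Dr S r n (?v i)"
    using Dr_mult[OF _ Dr_neg_wt] by simp
  show "\<forall>x\<in>Fn n. ?p x = 0 \<longrightarrow> g x = 0"
  proof (intro ballI impI)
    fix x assume x: "x \<in> Fn n" "?p x = 0"
    show "g x = 0"
    proof (rule ccontr)
      assume nz: "g x \<noteq> 0"
      \<comment> \<open>A negative value of g forces x off the set, where some f_i is negative and
        the defect is positive.\<close>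
      with x(1) assms have "0 < g x \<or> \<not> (\<forall>i\<in>{1..k}. 0 \<le> f i x)" by fastforce
      then have "0 < denom x" using denom_pos defect_pos by blast
      with nz x(2) show False by simp
    qed
  qed
  show "\<forall>x\<in>Fn n. (?p x)\<^sup>2 * g x = (?v 0 x)\<^sup>2 + (\<Sum>i=1..k. (?v i x)\<^sup>2 * f i x)"
  proof
    fix x :: "'a list" assume "x \<in> Fn n"
    have sum: "(\<Sum>i=1..k. (?v i x)\<^sup>2 * f i x) = - ((?b x)\<^sup>2 * defect x)"
      unfolding sum_scaled_neg_wt[symmetric] by (intro sum.cong) auto
    have p: "(?p x)\<^sup>2 * g x = g x ^ ?l * (denom x ^ (r + 1))\<^sup>2"
      by (simp add: power_mult_distrib power_mult[symmetric] mult_ac)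
    show "(?p x)\<^sup>2 * g x = (?v 0 x)\<^sup>2 + (\<Sum>i=1..k. (?v i x)\<^sup>2 * f i x)"
    \<comment> \<open>The supports are complementary: for g \<ge> 0 the factor b vanishes and only
      v_0 contributes, while for g < 0 the term v_0 vanishes and only the weighted sum
      contributes.\<close>
    proof (cases "0 \<le> g x")
      case True
      then have "(?u x)\<^sup>2 = g x ^ ?l * (denom x ^ (r + 1))\<^sup>2"
        using rt_power_odd[of "g x" r] by (simp add: power_mult_distrib del: power_Suc)
      moreover have "?b x = 0" using True rt_eq_0[of "- g x"] by simp
      ultimately show ?thesis unfolding sum p by simp
    next
      case False
      then have g0: "rt (g x) = 0" by (intro rt_eq_0) simp
      then have D: "denom x = defect x" by (simp add: denom_def)
      have "(?b x)\<^sup>2 * defect x = (- g x) ^ ?l * defect x ^ ?l * defect x"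
        using rt_power_odd[of "- g x" r] rt_power_odd[of "defect x" r] False defect_nonneg[of x]
        by (simp add: power_mult_distrib del: power_Suc)
      also have "\<dots> = (- g x) ^ ?l * (defect x ^ (r + 1))\<^sup>2"
        by (simp add: power_mult[symmetric] power2_eq_square power_add mult_2_right mult_ac)
      also have "(- g x) ^ ?l = - (g x ^ ?l)" by (rule power_minus_odd) simp
      finally have "(?b x)\<^sup>2 * defect x = - (g x ^ ?l) * (defect x ^ (r + 1))\<^sup>2" .
      then show ?thesis unfolding sum p unfolding D using g0 by simp
    qed
  qed
qed

lemma certificate_pos:
  assumes pos: "\<forall>x\<in>{x \<in> Fn n. \<forall>i\<in>{1..k}. f i x \<ge> 0}. g x > 0"
  shows "\<exists>v. (\<forall>i\<le>k. Dr S r n (v i)) \<and>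
              (\<forall>x\<in>Fn n. g x = (v 0 x)\<^sup>2 + (\<Sum>i=1..k. (v i x)\<^sup>2 * f i x))"
proof -
  \<comment> \<open>The numerator is chosen large enough that, where g \<le> 0 and
    \<open>denom\<close> equals N, the term b^2 N = (1 + g^2 + N^2)^2 / N outweighs - g.\<close>
  let ?b = "\<lambda>x. (1 + (g x)\<^sup>2 + (defect x)\<^sup>2) * inverse (denom x)"
  let ?h = "\<lambda>x. g x + (?b x)\<^sup>2 * defect x"
  have pos': "0 < g x \<or> 0 < defect x" if "x \<in> Fn n" for x
    using that pos defect_pos[of x] by blast
  then have denom: "0 < denom x" if "x \<in> Fn n" for x
    using that denom_pos by blast
  have b: "Dr S r n ?b"
    using denom by (intro Dr_mult Dr_add Dr_const Dr_power Dr_inverse g Dr_defect Dr_denom) fastforce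
  have h: "Dr S r n ?h"
    by (intro Dr_add Dr_mult Dr_power b g Dr_defect)
  have "0 < ?h x" if x: "x \<in> Fn n" for x
  proof (cases "0 < g x")
    case True
    then show ?thesis using defect_nonneg[of x] by (intro add_pos_nonneg) simp_all
  next
    case False
    with pos'[OF x] have N: "0 < defect x" by simp
    have "denom x = defect x" using False by (simp add: denom_def rt_eq_0)
    let ?t = "(g x)\<^sup>2 + (defect x)\<^sup>2"
    \<comment> \<open>Expanding the square gives -2 g N \<le> g^2 + N^2; as - g N is nonnegative, it
      satisfies the same bound.\<close>
    have "0 \<le> (- g x - defect x)\<^sup>2" by simp
    moreover have "0 \<le> - g x * defect x" using False N by (simp add: mult_le_0_iff)
    ultimately have "- g x * defect x \<le> ?t" by (simp add: power2_eq_square algebra_simps)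
    also have "?t < (1 + ?t) * (1 + ?t)"
    proof -
      have "0 \<le> ?t" by simp
      then have "?t < 1 + ?t" "1 + ?t \<le> (1 + ?t) * (1 + ?t)" by (simp_all add: distrib_left)
      then show ?thesis by (rule less_le_trans)
    qed
    finally have "- g x < (1 + ?t) * (1 + ?t) / defect x"
      using N by (simp add: less_divide_eq)
    also have "\<dots> = (?b x)\<^sup>2 * defect x"
      unfolding \<open>denom x = defect x\<close> using N by (simp add: field_simps power2_eq_square)
    finally show ?thesis by simp
  qed
  from Dr_rt[OF h this] obtain v0 where v0: "Dr S r n v0" "\<And>x. x \<in> Fn n \<Longrightarrow> (v0 x)\<^sup>2 = ?h x"
    by blast
  let ?v = "\<lambda>i. if i = 0 then v0 else (\<lambda>x. ?b x * neg_wt i x)"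
  show ?thesis
  proof (intro exI conjI ballI)
    show "\<forall>i\<le>k. Dr S r n (?v i)"
      using v0(1) Dr_mult[OF b Dr_neg_wt] by simp
    fix x :: "'a list" assume x: "x \<in> Fn n"
    have "(\<Sum>i=1..k. (?v i x)\<^sup>2 * f i x) = - ((?b x)\<^sup>2 * defect x)"
      unfolding sum_scaled_neg_wt[symmetric] by (intro sum.cong) auto
    then show "g x = (?v 0 x)\<^sup>2 + (\<Sum>i=1..k. (?v i x)\<^sup>2 * f i x)"
      using v0(2)[OF x] by simp
  qed
qed

end

end

theorem theorem3p14:
  fixes S :: "nat \<Rightarrow> 'a::linordered_field list set set"
    and r n k :: nat and f :: "nat \<Rightarrow> 'a list \<Rightarrow> 'a" and g :: "'a list \<Rightarrow> 'a"
  assumes "dstructure S" and "def_complete S" and "loc_omin S"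
    and "\<forall>i\<in>{1..k}. Dr S r n (f i)"
    and "{x \<in> Fn n. \<forall>i\<in>{1..k}. f i x \<ge> 0} \<noteq> {}"
    and "Dr S r n g"
  shows "((\<forall>x\<in>{x \<in> Fn n. \<forall>i\<in>{1..k}. f i x \<ge> 0}. g x \<ge> 0) \<longrightarrow>
           (\<exists>p v. Dr S r n p \<and> (\<forall>i\<le>k. Dr S r n (v i)) \<and>
              (\<forall>x\<in>Fn n. p x = 0 \<longrightarrow> g x = 0) \<and>
              (\<forall>x\<in>Fn n. (p x)\<^sup>2 * g x = (v 0 x)\<^sup>2 + (\<Sum>i=1..k. (v i x)\<^sup>2 * f i x))))
       \<and> ((\<forall>x\<in>{x \<in> Fn n. \<forall>i\<in>{1..k}. f i x \<ge> 0}. g x > 0) \<longrightarrow>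
           (\<exists>v. (\<forall>i\<le>k. Dr S r n (v i)) \<and>
              (\<forall>x\<in>Fn n. g x = (v 0 x)\<^sup>2 + (\<Sum>i=1..k. (v i x)\<^sup>2 * f i x))))"
proof -
  have "\<exists>s. 0 \<le> s \<and> s * s = max 0 a" for a :: 'a
    using def_complete_imp_sqrt[OF assms(1,2), of "max 0 a"] by simp
  \<comment> \<open>The function \<open>rt\<close> comes from choice and carries no definability by
    itself. Its defining property determines it uniquely by a polynomial condition, which is how
    \<open>definable_fun_rt\<close> obtains definability of its compositions.\<close>
  then obtain rt :: "'a \<Rightarrow> 'a" where "\<And>a. 0 \<le> rt a \<and> rt a * rt a = max 0 a"
    by metis
  with assms(1) interpret definable_sqrt S rt
    by unfold_locales auto
  show ?thesis
    using certificate_nonneg[of k r n f g] certificate_pos[of k r n f g] assms(4,6) by blast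
qed

end
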